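(* Let $n\ge2$, let $\sigma>0$ and let $\kappa=(\kappa_1,\dots,\kappa_n)\in\mathbb{R}^n$ with $H=\sum_{j}\kappa_j$ satisfy $H-\kappa_j>0$ for all $j$ and $\prod_{j=1}^n(H-\kappa_j)=((n-1)\sigma)^n$. Let $\beta>1$, $\nu>0$, $u>0$ be real numbers, fix $i\in\{1,\dots,n\}$ and let $u_i\in\mathbb{R}$. Put $$R_i=\sum_{j\ne i}\frac{1}{3H-2\kappa_j-\kappa_i},\qquad D_i=-\frac{n^2+n}{4}H+\frac{n^2+3n-2}{4}\kappa_i+\frac14(H-\kappa_i)\big((3n+4)H-(n+6)\kappa_i\big)R_i ,$$ and assume $D_i\neq0$. Consider the quadratic form in $t=(t_1,\dots,t_n)\in\mathbb{R}^n$ $$\begin{aligned}Q_i=&\ \frac{2\sigma}{n}\frac{1}{H-\kappa_i}\sum_{j\ne i}\frac{t_j^2}{H-\kappa_j}-\frac{\sigma}{n}\sum_{j\ne l}\ \sum_{\substack{p<q\\ p,q\notin\{j,l\}}}\frac{t_jt_l}{(H-\kappa_p)(H-\kappa_q)}\\&-\frac{\sigma}{n}\sum_j\Big(2\sum_{\substack{p<q\\ p,q\ne j}}\frac{1}{(H-\kappa_p)(H-\kappa_q)}-\sum_{p<q}\frac{1}{(H-\kappa_p)(H-\kappa_q)}\Big)t_j^2\\&-\frac{\beta^2}{\nu^2}\frac{u_i^2}{u^2}(\nu-\kappa_i)^2H^2\,\frac{\sigma}{n}\sum_{p<q}\frac{1}{(H-\kappa_p)(H-\kappa_q)}\end{aligned}$$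 subject to the two linear constraints $$\sum_{j=1}^n f_j t_j=0,\qquad \sum_{j=1}^n t_j=\frac{\beta}{\nu}\frac{u_i}{u}(\nu-\kappa_i)H,\qquad\text{where } f_j=\frac{\sigma}{n}\sum_{p\ne j}\frac{1}{H-\kappa_p}.$$ Then the minimum of $Q_i$ under these constraints is achieved at $$t_i=\frac{\beta}{\nu}\frac{u_i}{u}(\kappa_i-\nu)H\cdot\frac{\frac{n^2+n}{4}H-\frac{n^2+3n-2}{4}\kappa_i-\frac14(H-\kappa_i)\big(3nH+(3n-6)\kappa_i\big)R_i}{D_i},$$ and, for $j\ne i$, $$t_j=\frac{\beta}{\nu}\frac{u_i}{u}(\kappa_i-\nu)H\cdot\frac{\Big(\frac{n^2+n}{4}H-\frac{n^2+3n-2}{4}\kappa_i\Big)\frac{H-\kappa_i}{3H-2\kappa_j-\kappa_i}+(H-\kappa_i)\Big(-\frac n4H-\frac{n+2}{2}\kappa_j+\big(\frac n4+\frac32\big)\kappa_i\Big)R_i}{D_i}.$$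
   Context: All sums over indices run over $\{1,\dots,n\}$ subject to the displayed restrictions; $\sum_{j\neq l}$ is over ordered pairs. In the geometric setting, $\kappa$ are the principal curvatures at a point of an admissible hypersurface in hyperbolic space satisfying $f(\kappa)=\frac{1}{n-1}\big(\prod_j(H-\kappa_j)\big)^{1/n}=\sigma$, $f_j=\partial f/\partial\kappa_j$, $u$ is the height function, $u_i$ its derivative in the $i$-th direction, and $\nu$ (written $\nu^{n+1}$ in that setting) is the vertical component of the Euclidean unit normal; in the statement they are just real numbers. Note $3H-2\kappa_j-\kappa_i=2(H-\kappa_j)+(H-\kappa_i)>0$. *)

theory Defs
  imports "HOL-Analysis.Analysis"
begin

text \<open>
  The index set \<open>{1,\<dots>,n}\<close> is a finite linearly ordered type \<open>'n\<close>, with \<open>n = CARD('n)\<close>; the linear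
  order serves only to write sums over \<open>p < q\<close>.
\<close>

definition trH :: "real ^ ('n::finite) \<Rightarrow> real" where
  "trH \<kappa> = (\<Sum>j\<in>UNIV. \<kappa> $ j)"

definition pair_sum :: "real ^ ('n::{finite,linorder}) \<Rightarrow> ('n::{finite,linorder}) set \<Rightarrow> real" where
  "pair_sum \<kappa> S =
     (\<Sum>(p,q) | p < q \<and> p \<notin> S \<and> q \<notin> S. 1 / ((trH \<kappa> - \<kappa> $ p) * (trH \<kappa> - \<kappa> $ q)))"

text \<open>
  The partial derivatives \<open>f\<^sub>j\<close> of \<open>f(\<kappa>) = (\<Prod>\<^sub>j (H - \<kappa>\<^sub>j))\<^bsup>1/n\<^esup> / (n - 1)\<close> at a point where \<open>f(\<kappa>) = \<sigma>\<close>.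
\<close>

definition fder :: "real \<Rightarrow> real ^ ('n::finite) \<Rightarrow> 'n::finite \<Rightarrow> real" where
  "fder \<sigma> \<kappa> j = \<sigma> / real CARD('n) * (\<Sum>p | p \<noteq> j. 1 / (trH \<kappa> - \<kappa> $ p))"

definition Rsum :: "real ^ ('n::finite) \<Rightarrow> 'n::finite \<Rightarrow> real" where
  "Rsum \<kappa> i = (\<Sum>j | j \<noteq> i. 1 / (3 * trH \<kappa> - 2 * \<kappa> $ j - \<kappa> $ i))"

definition Dden :: "real ^ ('n::finite) \<Rightarrow> 'n::finite \<Rightarrow> real" where
  "Dden \<kappa> i = (let n = real CARD('n); H = trH \<kappa> in
     - ((n^2 + n) / 4) * H + (n^2 + 3 * n - 2) / 4 * \<kappa> $ i
     + 1/4 * (H - \<kappa> $ i) * ((3 * n + 4) * H - (n + 6) * \<kappa> $ i) * Rsum \<kappa> i)"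

text \<open>In what follows \<open>w\<close> stands for the derivative \<open>u\<^sub>i\<close> of the height function \<open>u\<close>.\<close>

definition Qform ::
  "real \<Rightarrow> real ^ ('n::{finite,linorder}) \<Rightarrow> real \<Rightarrow> real \<Rightarrow> real \<Rightarrow> real \<Rightarrow>
   'n::{finite,linorder} \<Rightarrow> real ^ ('n::{finite,linorder}) \<Rightarrow> real" where
  "Qform \<sigma> \<kappa> \<beta> \<nu> u w i t = (let n = real CARD('n); H = trH \<kappa> in
       2 * \<sigma> / n * (1 / (H - \<kappa> $ i)) * (\<Sum>j | j \<noteq> i. (t $ j)^2 / (H - \<kappa> $ j))
     - \<sigma> / n * (\<Sum>(j,l) | j \<noteq> l.
         \<Sum>(p,q) | p < q \<and> p \<notin> {j,l} \<and> q \<notin> {j,l}. t $ j * t $ l / ((H - \<kappa> $ p) * (H - \<kappa> $ q)))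
     - \<sigma> / n * (\<Sum>j\<in>UNIV. (2 * pair_sum \<kappa> {j} - pair_sum \<kappa> {}) * (t $ j)^2)
     - \<beta>^2 / \<nu>^2 * (w^2 / u^2) * (\<nu> - \<kappa> $ i)^2 * H^2 * (\<sigma> / n) * pair_sum \<kappa> {})"

definition feasible ::
  "real \<Rightarrow> real ^ ('n::finite) \<Rightarrow> real \<Rightarrow> real \<Rightarrow> real \<Rightarrow> real \<Rightarrow> 'n::finite \<Rightarrow> real ^ ('n::finite) \<Rightarrow> bool" where
  "feasible \<sigma> \<kappa> \<beta> \<nu> u w i t \<longleftrightarrow>
     (\<Sum>j\<in>UNIV. fder \<sigma> \<kappa> j * t $ j) = 0 \<and>
     (\<Sum>j\<in>UNIV. t $ j) = \<beta> / \<nu> * (w / u) * (\<nu> - \<kappa> $ i) * trH \<kappa>"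

definition tmin ::
  "real ^ ('n::finite) \<Rightarrow> real \<Rightarrow> real \<Rightarrow> real \<Rightarrow> real \<Rightarrow> 'n::finite \<Rightarrow> real ^ ('n::finite)" where
  "tmin \<kappa> \<beta> \<nu> u w i = (let n = real CARD('n); H = trH \<kappa>; R = Rsum \<kappa> i; D = Dden \<kappa> i in
     (\<chi> j. \<beta> / \<nu> * (w / u) * (\<kappa> $ i - \<nu>) * H *
       (if j = i then
          ((n^2 + n) / 4 * H - (n^2 + 3 * n - 2) / 4 * \<kappa> $ i
             - 1/4 * (H - \<kappa> $ i) * (3 * n * H + (3 * n - 6) * \<kappa> $ i) * R) / D
        else
          (((n^2 + n) / 4 * H - (n^2 + 3 * n - 2) / 4 * \<kappa> $ i)
               * ((H - \<kappa> $ i) / (3 * H - 2 * \<kappa> $ j - \<kappa> $ i))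
             + (H - \<kappa> $ i) * (- (n / 4) * H - (n + 2) / 2 * \<kappa> $ j + (n / 4 + 3 / 2) * \<kappa> $ i) * R) / D)))"

end

theory Submission
  imports Defs
begin

text \<open>
  Put \<open>x\<^sub>j = H - \<kappa>\<^sub>j\<close>, \<open>a\<^sub>j = 1 / x\<^sub>j\<close>, \<open>S = \<Sum> a\<^sub>j\<close>, and let \<open>T\<close> be the prescribed value of \<open>\<Sum> t\<^sub>j\<close>.
  The constraints say \<open>\<Sum> t\<^sub>j = T\<close> and \<open>\<Sum> a\<^sub>j t\<^sub>j = S T\<close>. The sums over \<open>p < q\<close> are elementary symmetric
  polynomials of degree 2 in the \<open>a\<^sub>j\<close> with up to two indices omitted, hence polynomials in
  \<open>S\<close>, \<open>\<Sum> a\<^sub>j\<^sup>2\<close> and the omitted \<open>a\<^sub>j\<close>. Consequently, on the feasible set, \<open>Q\<^sub>i\<close> equals up to an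
  additive constant \<open>\<sigma>/n\<close> times \<open>\<Sum> c\<^sub>j t\<^sub>j\<^sup>2 - 2 T \<Sum> a\<^sub>j\<^sup>2 t\<^sub>j\<close> with \<open>c\<^sub>i = a\<^sub>i\<^sup>2\<close> and
  \<open>c\<^sub>j = a\<^sub>j\<^sup>2 + 2 a\<^sub>i a\<^sub>j\<close> for \<open>j \<noteq> i\<close>. This is convex, so a feasible point at which
  \<open>c\<^sub>j t\<^sub>j - T a\<^sub>j\<^sup>2\<close> has the form \<open>\<lambda> + \<mu> a\<^sub>j\<close> (Lagrange multipliers) is a minimum.
\<close>

section \<open>Sums over pairs as symmetric polynomials\<close>

text \<open>The square \<open>A \<times> A\<close> splits into two triangles and the diagonal;
  swapping coordinates shows that both triangles contribute equally.\<close>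

lemma sum_less_pairs:
  fixes g :: "'n::{finite,linorder} \<Rightarrow> real"
  shows "(\<Sum>(p,q) | p < q \<and> p \<in> A \<and> q \<in> A. g p * g q) = ((\<Sum>p\<in>A. g p)^2 - (\<Sum>p\<in>A. (g p)^2)) / 2"
proof -
  let ?h = "\<lambda>(p,q). g p * g q"
  let ?L = "{(p,q). p < q \<and> p \<in> A \<and> q \<in> A}" and ?G = "{(p,q). q < p \<and> p \<in> A \<and> q \<in> A}"
    and ?E = "(\<lambda>p. (p,p)) ` A"
  have "(\<Sum>p\<in>A. g p)^2 = sum ?h (A \<times> A)"
    by (simp add: power2_eq_square sum_product sum.cartesian_product)
  also have "A \<times> A = (?L \<union> ?G) \<union> ?E"
    by auto
  also have "sum ?h \<dots> = sum ?h ?L + sum ?h ?G + sum ?h ?E"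
    by (subst sum.union_disjoint; (subst sum.union_disjoint)?; auto)
  also have "sum ?h ?G = sum ?h ?L"
    by (rule sum.reindex_bij_witness[of _ prod.swap prod.swap]) auto
  also have "sum ?h ?E = (\<Sum>p\<in>A. (g p)^2)"
    by (subst sum.reindex) (auto simp: inj_on_def power2_eq_square)
  finally show ?thesis by simp
qed

lemma pair_sum_eq:
  fixes \<kappa> :: "real ^ ('n::{finite,linorder})"
  shows "pair_sum \<kappa> X = ((\<Sum>p\<in>-X. 1 / (trH \<kappa> - \<kappa> $ p))^2 - (\<Sum>p\<in>-X. (1 / (trH \<kappa> - \<kappa> $ p))^2)) / 2"
  unfolding pair_sum_def
  by (subst sum_less_pairs[symmetric]) (auto intro!: sum.cong)

lemma sum_Compl_insert:
  fixes g :: "'n::finite \<Rightarrow> 'a::ab_group_add"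
  assumes "j \<notin> X"
  shows "sum g (- insert j X) = sum g (- X) - g j"
proof -
  have "- insert j X = - X - {j}" by auto
  with assms show ?thesis by (simp add: sum_diff1)
qed

lemma sum_neq_pairs:
  fixes g :: "'n::finite \<Rightarrow> 'n \<Rightarrow> real"
  shows "(\<Sum>(j,l) | j \<noteq> l. g j l) = (\<Sum>j\<in>UNIV. \<Sum>l\<in>UNIV. g j l) - (\<Sum>j\<in>UNIV. g j j)"
proof -
  let ?h = "\<lambda>(j,l). g j l"
  have "(\<Sum>j\<in>UNIV. \<Sum>l\<in>UNIV. g j l) = sum ?h UNIV"
    by (simp add: sum.cartesian_product)
  also have "(UNIV :: ('n \<times> 'n) set) = {(j,l). j \<noteq> l} \<union> (\<lambda>j. (j,j)) ` UNIV"
    by auto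
  also have "sum ?h \<dots> = sum ?h {(j,l). j \<noteq> l} + sum ?h ((\<lambda>j. (j,j)) ` UNIV)"
    by (subst sum.union_disjoint) auto
  also have "sum ?h ((\<lambda>j. (j,j)) ` UNIV) = (\<Sum>j\<in>UNIV. g j j)"
    by (subst sum.reindex) (auto simp: inj_on_def)
  finally show ?thesis by simp
qed

lemma sum_neq:
  fixes g :: "'n::finite \<Rightarrow> real"
  shows "(\<Sum>j | j \<noteq> i. g j) = (\<Sum>j\<in>UNIV. g j) - g i"
  using sum_Compl_insert[of i "{}" g] by (simp add: Compl_eq)

text \<open>Omitting \<open>j\<close> discards exactly the pairs containing \<open>j\<close>, whose
  total is \<open>a j * (S - a j)\<close> with \<open>S\<close> the sum of all
  \<open>a p\<close>.\<close>

lemma pair_sum_single: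
  fixes \<kappa> :: "real ^ ('n::{finite,linorder})"
  defines "a \<equiv> \<lambda>p. 1 / (trH \<kappa> - \<kappa> $ p)"
  shows "pair_sum \<kappa> {j} = pair_sum \<kappa> {} - a j * (\<Sum>p\<in>UNIV. a p) + (a j)^2"
proof -
  have "pair_sum \<kappa> X = ((\<Sum>p\<in>-X. a p)^2 - (\<Sum>p\<in>-X. (a p)^2)) / 2" for X
    unfolding a_def by (rule pair_sum_eq)
  then show ?thesis
    by (simp only:) (simp add: sum_Compl_insert field_simps power2_eq_square)
qed

text \<open>Inclusion-exclusion: removing the pairs through \<open>j\<close> and those through
  \<open>l\<close> removes the pair of \<open>j\<close> and \<open>l\<close> twice, hence the final
  \<open>+ a j * a l\<close>.\<close>

lemma pair_sum_two:
  fixes \<kappa> :: "real ^ ('n::{finite,linorder})"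
  defines "a \<equiv> \<lambda>p. 1 / (trH \<kappa> - \<kappa> $ p)"
  assumes "j \<noteq> l"
  shows "pair_sum \<kappa> {j, l} = pair_sum \<kappa> {} - (a j + a l) * (\<Sum>p\<in>UNIV. a p)
    + (a j)^2 + (a l)^2 + a j * a l"
proof -
  have "pair_sum \<kappa> X = ((\<Sum>p\<in>-X. a p)^2 - (\<Sum>p\<in>-X. (a p)^2)) / 2" for X
    unfolding a_def by (rule pair_sum_eq)
  then show ?thesis
    using assms(2) by (simp only:) (simp add: sum_Compl_insert field_simps power2_eq_square)
qed

text \<open>The bracket is the closed form from \<open>pair_sum_two\<close>, here also used at
  \<open>j = l\<close>. Each of its monomials separates \<open>j\<close> from \<open>l\<close>, so
  the double sum factors into single sums.\<close>

lemma sum_symmetric_form: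
  fixes a t :: "'n::finite \<Rightarrow> real"
  shows "(\<Sum>j\<in>UNIV. \<Sum>l\<in>UNIV. t j * t l * (e - (a j + a l) * S + (a j)^2 + (a l)^2 + a j * a l)) =
    e * (\<Sum>j\<in>UNIV. t j)^2 - 2 * S * (\<Sum>j\<in>UNIV. a j * t j) * (\<Sum>j\<in>UNIV. t j)
    + 2 * (\<Sum>j\<in>UNIV. (a j)^2 * t j) * (\<Sum>j\<in>UNIV. t j) + (\<Sum>j\<in>UNIV. a j * t j)^2"
proof -
  let ?T = "\<Sum>j\<in>UNIV. t j" and ?A = "\<Sum>j\<in>UNIV. a j * t j" and ?B = "\<Sum>j\<in>UNIV. (a j)^2 * t j"
  have "(\<Sum>l\<in>UNIV. t j * t l * (e - (a j + a l) * S + (a j)^2 + (a l)^2 + a j * a l))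
      = (\<Sum>l\<in>UNIV. (t j * (e - a j * S + (a j)^2)) * t l + (t j * (a j - S)) * (a l * t l)
          + t j * ((a l)^2 * t l))" for j
    by (intro sum.cong refl) (simp add: algebra_simps)
  then have "(\<Sum>j\<in>UNIV. \<Sum>l\<in>UNIV. t j * t l * (e - (a j + a l) * S + (a j)^2 + (a l)^2 + a j * a l))
      = (\<Sum>j\<in>UNIV. t j * (e - a j * S + (a j)^2) * ?T + (t j * (a j - S)) * ?A + t j * ?B)"
    by (simp only: sum.distrib sum_distrib_left[symmetric])
  also have "\<dots> = (\<Sum>j\<in>UNIV. (e * ?T - S * ?A + ?B) * t j + (?A - S * ?T) * (a j * t j)
      + ?T * ((a j)^2 * t j))"
    by (intro sum.cong refl) (simp add: algebra_simps)
  also have "\<dots> = (e * ?T - S * ?A + ?B) * ?T + (?A - S * ?T) * ?A + ?T * ?B"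
    by (simp only: sum.distrib sum_distrib_left[symmetric])
  finally show ?thesis
    by (simp add: algebra_simps power2_eq_square)
qed

section \<open>The constraints and the form on the feasible set\<close>

text \<open>The coefficients \<open>c\<close> of the outline, in terms of
  \<open>x j = H - \<kappa> $ j\<close>; the term \<open>2 / (x i * x j)\<close> comes from the
  first sum of \<open>Qform\<close>.\<close>

definition quad_coeff :: "('n \<Rightarrow> real) \<Rightarrow> 'n \<Rightarrow> 'n \<Rightarrow> real" where
  "quad_coeff x i j = (1 / x j)^2 + (if j = i then 0 else 2 / (x i * x j))"

text \<open>With \<open>S\<close> the sum of all \<open>a p\<close>,
  \<open>fder \<sigma> \<kappa> j\<close> is \<open>\<sigma> / n * (S - a j)\<close>, and the
  nonzero factor \<open>\<sigma> / n\<close> can be cancelled.\<close>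

lemma feasible_iff:
  fixes \<kappa> :: "real ^ ('n::finite)"
  assumes "\<sigma> > 0"
  defines "a \<equiv> \<lambda>p. 1 / (trH \<kappa> - \<kappa> $ p)"
  shows "feasible \<sigma> \<kappa> \<beta> \<nu> u w i t \<longleftrightarrow>
    (\<Sum>j\<in>UNIV. t $ j) = \<beta> / \<nu> * (w / u) * (\<nu> - \<kappa> $ i) * trH \<kappa> \<and>
    (\<Sum>j\<in>UNIV. a j * t $ j) = (\<Sum>p\<in>UNIV. a p) * (\<Sum>j\<in>UNIV. t $ j)"
proof -
  have "(\<Sum>j\<in>UNIV. fder \<sigma> \<kappa> j * t $ j)
      = (\<Sum>j\<in>UNIV. \<sigma> / real CARD('n) * ((\<Sum>p\<in>UNIV. a p) * t $ j - a j * t $ j))"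
    by (intro sum.cong refl) (simp add: fder_def sum_neq a_def algebra_simps)
  also have "\<dots> = \<sigma> / real CARD('n) * ((\<Sum>p\<in>UNIV. a p) * (\<Sum>j\<in>UNIV. t $ j) - (\<Sum>j\<in>UNIV. a j * t $ j))"
    by (simp only: sum_subtractf sum_distrib_left[symmetric])
  finally show ?thesis
    unfolding feasible_def using assms(1) by auto
qed

lemma Qform_eq_on_feasible:
  fixes \<kappa> :: "real ^ ('n::{finite,linorder})"
  assumes "\<sigma> > 0" and "feasible \<sigma> \<kappa> \<beta> \<nu> u w i t"
  defines "a \<equiv> \<lambda>p. 1 / (trH \<kappa> - \<kappa> $ p)" and "T \<equiv> \<beta> / \<nu> * (w / u) * (\<nu> - \<kappa> $ i) * trH \<kappa>"
  shows "Qform \<sigma> \<kappa> \<beta> \<nu> u w i t = \<sigma> / real CARD('n) *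
    ((\<Sum>j\<in>UNIV. quad_coeff (\<lambda>j. trH \<kappa> - \<kappa> $ j) i j * (t $ j)^2 - 2 * T * ((a j)^2 * t $ j))
      + T^2 * ((\<Sum>p\<in>UNIV. a p)^2 - 2 * pair_sum \<kappa> {}))"
proof -
  let ?s = "\<sigma> / real CARD('n)" and ?S = "\<Sum>p\<in>UNIV. a p" and ?e = "pair_sum \<kappa> {}"
  let ?B = "\<Sum>j\<in>UNIV. (a j)^2 * t $ j"
  have T: "(\<Sum>j\<in>UNIV. t $ j) = T" and A: "(\<Sum>j\<in>UNIV. a j * t $ j) = ?S * T"
    using assms(2) feasible_iff[OF assms(1), of \<kappa> \<beta> \<nu> u w i t] by (auto simp: a_def T_def)
  have inner: "(\<Sum>(p,q) | p < q \<and> p \<notin> {j,l} \<and> q \<notin> {j,l}.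
        t $ j * t $ l / ((trH \<kappa> - \<kappa> $ p) * (trH \<kappa> - \<kappa> $ q))) = t $ j * t $ l * pair_sum \<kappa> {j,l}" for j l
    unfolding pair_sum_def sum_distrib_left by (intro sum.cong) auto
  \<comment> \<open>For \<open>j \<noteq> l\<close> the bracket is
    \<open>pair_sum \<kappa> {j, l}\<close>. On the diagonal it is only a formal extension that
    makes the double sum factor; those terms are subtracted again.\<close>
  let ?g = "\<lambda>j l. t $ j * t $ l * (?e - (a j + a l) * ?S + (a j)^2 + (a l)^2 + a j * a l)"
  have "(\<Sum>(j,l) | j \<noteq> l. \<Sum>(p,q) | p < q \<and> p \<notin> {j,l} \<and> q \<notin> {j,l}.
        t $ j * t $ l / ((trH \<kappa> - \<kappa> $ p) * (trH \<kappa> - \<kappa> $ q))) = (\<Sum>(j,l) | j \<noteq> l. ?g j l)"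
    unfolding inner by (intro sum.cong) (auto simp: pair_sum_two a_def)
  \<comment> \<open>The constraints turn the two products involving the sum of
    \<open>a j * t $ j\<close> into \<open>- 2 * ?S^2 * T^2 + ?S^2 * T^2\<close>.\<close>
  also have "\<dots> = ?e * T^2 - ?S^2 * T^2 + 2 * ?B * T - (\<Sum>j\<in>UNIV. ?g j j)"
    unfolding sum_neq_pairs sum_symmetric_form[of "\<lambda>j. t $ j" ?e a ?S] T A
    by (simp add: power2_eq_square)
  finally have cross: "(\<Sum>(j,l) | j \<noteq> l. \<Sum>(p,q) | p < q \<and> p \<notin> {j,l} \<and> q \<notin> {j,l}.
        t $ j * t $ l / ((trH \<kappa> - \<kappa> $ p) * (trH \<kappa> - \<kappa> $ q)))
      = ?e * T^2 - ?S^2 * T^2 + 2 * ?B * T - (\<Sum>j\<in>UNIV. ?g j j)" .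
  have "2 * a i * (\<Sum>j | j \<noteq> i. (t $ j)^2 / (trH \<kappa> - \<kappa> $ j))
      = (\<Sum>j\<in>UNIV. if j \<noteq> i then 2 * a i * ((t $ j)^2 / (trH \<kappa> - \<kappa> $ j)) else 0)"
    by (simp add: sum.If_cases sum_distrib_left)
  then have "2 * a i * (\<Sum>j | j \<noteq> i. (t $ j)^2 / (trH \<kappa> - \<kappa> $ j)) + (\<Sum>j\<in>UNIV. ?g j j)
        - (\<Sum>j\<in>UNIV. (2 * pair_sum \<kappa> {j} - ?e) * (t $ j)^2)
      = (\<Sum>j\<in>UNIV. (if j \<noteq> i then 2 * a i * ((t $ j)^2 / (trH \<kappa> - \<kappa> $ j)) else 0) + ?g j j
          - (2 * pair_sum \<kappa> {j} - ?e) * (t $ j)^2)"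
    by (simp only: sum.distrib sum_subtractf)
  also have "\<dots> = (\<Sum>j\<in>UNIV. quad_coeff (\<lambda>j. trH \<kappa> - \<kappa> $ j) i j * (t $ j)^2)"
  proof (intro sum.cong refl)
    fix j
    \<comment> \<open>The formal diagonal bracket is \<open>?e - 2 * a j * ?S + 3 * (a j)^2\<close>,
      and the coefficient from \<open>Qform\<close> is
      \<open>?e - 2 * a j * ?S + 2 * (a j)^2\<close>; only \<open>(a j)^2\<close> survives.\<close>
    have "?g j j - (2 * pair_sum \<kappa> {j} - ?e) * (t $ j)^2 = (a j)^2 * (t $ j)^2"
    proof -
      have "pair_sum \<kappa> {j} = ?e - a j * ?S + (a j)^2"
        unfolding a_def by (rule pair_sum_single)
      then show ?thesis by (simp only:) (simp add: power2_eq_square algebra_simps)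
    qed
    moreover have "quad_coeff (\<lambda>j. trH \<kappa> - \<kappa> $ j) i j * (t $ j)^2
        = (if j \<noteq> i then 2 * a i * ((t $ j)^2 / (trH \<kappa> - \<kappa> $ j)) else 0) + (a j)^2 * (t $ j)^2"
      by (simp add: quad_coeff_def a_def distrib_right power_one_over)
    ultimately show "(if j \<noteq> i then 2 * a i * ((t $ j)^2 / (trH \<kappa> - \<kappa> $ j)) else 0) + ?g j j
        - (2 * pair_sum \<kappa> {j} - ?e) * (t $ j)^2 = quad_coeff (\<lambda>j. trH \<kappa> - \<kappa> $ j) i j * (t $ j)^2"
      by linarith
  qed
  finally have diag: "2 * a i * (\<Sum>j | j \<noteq> i. (t $ j)^2 / (trH \<kappa> - \<kappa> $ j))
      = (\<Sum>j\<in>UNIV. quad_coeff (\<lambda>j. trH \<kappa> - \<kappa> $ j) i j * (t $ j)^2) - (\<Sum>j\<in>UNIV. ?g j j)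
        + (\<Sum>j\<in>UNIV. (2 * pair_sum \<kappa> {j} - ?e) * (t $ j)^2)"
    by linarith
  have "2 * \<sigma> / real CARD('n) * (1 / (trH \<kappa> - \<kappa> $ i)) * (\<Sum>j | j \<noteq> i. (t $ j)^2 / (trH \<kappa> - \<kappa> $ j))
      = ?s * (2 * a i * (\<Sum>j | j \<noteq> i. (t $ j)^2 / (trH \<kappa> - \<kappa> $ j)))"
    by (simp add: a_def)
  moreover have "\<beta>^2 / \<nu>^2 * (w^2 / u^2) * (\<nu> - \<kappa> $ i)^2 * (trH \<kappa>)^2 * ?s * ?e = ?s * (T^2 * ?e)"
    by (simp add: T_def power_mult_distrib power_divide ac_simps)
  ultimately have "Qform \<sigma> \<kappa> \<beta> \<nu> u w i t = ?s * ((\<Sum>j\<in>UNIV. quad_coeff (\<lambda>j. trH \<kappa> - \<kappa> $ j) i j * (t $ j)^2)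
      - (?e * T^2 - ?S^2 * T^2 + 2 * ?B * T) - T^2 * ?e)"
    unfolding Qform_def Let_def cross diag by (simp add: right_diff_distrib distrib_left)
  also have "(\<Sum>j\<in>UNIV. quad_coeff (\<lambda>j. trH \<kappa> - \<kappa> $ j) i j * (t $ j)^2) - (?e * T^2 - ?S^2 * T^2 + 2 * ?B * T) - T^2 * ?e
      = (\<Sum>j\<in>UNIV. quad_coeff (\<lambda>j. trH \<kappa> - \<kappa> $ j) i j * (t $ j)^2 - 2 * T * ((a j)^2 * t $ j)) + T^2 * (?S^2 - 2 * ?e)"
    by (simp only: sum_subtractf sum_distrib_left[symmetric]) (simp add: algebra_simps)
  finally show ?thesis .
qed

section \<open>Sufficiency of the Lagrange condition\<close>

text \<open>The difference of the objectives at \<open>s\<close> and \<open>t\<close> is the sum of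
  \<open>c j * (s j - t j)^2\<close> plus twice that of
  \<open>(c j * t j - b j) * (s j - t j)\<close>. The latter vanishes, since \<open>s - t\<close> is
  orthogonal to the constant vector and to \<open>a\<close>.\<close>

lemma lagrange_sufficient:
  fixes a b c s t :: "'n \<Rightarrow> real"
  assumes "\<And>j. j \<in> I \<Longrightarrow> c j \<ge> 0"
    and "\<And>j. j \<in> I \<Longrightarrow> c j * t j - b j = l + m * a j"
    and "sum s I = sum t I" and "(\<Sum>j\<in>I. a j * s j) = (\<Sum>j\<in>I. a j * t j)"
  shows "(\<Sum>j\<in>I. c j * (t j)^2 - 2 * (b j * t j)) \<le> (\<Sum>j\<in>I. c j * (s j)^2 - 2 * (b j * s j))"
proof -
  have "(\<Sum>j\<in>I. c j * (s j)^2 - 2 * (b j * s j)) - (\<Sum>j\<in>I. c j * (t j)^2 - 2 * (b j * t j))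
      = (\<Sum>j\<in>I. c j * (s j - t j)^2 + 2 * l * (s j - t j) + 2 * m * (a j * s j - a j * t j))"
    unfolding sum_subtractf[symmetric]
  proof (intro sum.cong refl)
    fix j assume "j \<in> I"
    then have b: "b j = c j * t j - l - m * a j"
      using assms(2) by fastforce
    show "c j * (s j)^2 - 2 * (b j * s j) - (c j * (t j)^2 - 2 * (b j * t j))
        = c j * (s j - t j)^2 + 2 * l * (s j - t j) + 2 * m * (a j * s j - a j * t j)"
      unfolding b by (simp add: power2_eq_square algebra_simps)
  qed
  also have "\<dots> = (\<Sum>j\<in>I. c j * (s j - t j)^2)"
    using assms(3,4) by (simp add: sum.distrib sum_distrib_left[symmetric] sum_subtractf)
  also have "\<dots> \<ge> 0"
    using assms(1) by (intro sum_nonneg) simp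
  finally show ?thesis by linarith
qed

section \<open>The candidate point in the variables \<open>x\<close>\<close>

text \<open>After substituting \<open>x j = H - \<kappa> $ j\<close>, \<open>X\<close> is
  \<open>(n - 1) * H\<close>, \<open>D\<close> is \<open>Dden\<close>, \<open>P\<close> is the part
  of both numerators free of \<open>\<kappa> $ j\<close> and \<open>R\<close>, and \<open>t\<close>
  is \<open>tmin\<close>.\<close>

context
  fixes x :: "'n::finite \<Rightarrow> real" and i :: 'n and T n R X P D :: real and t :: "'n \<Rightarrow> real"
  defines "n \<equiv> real CARD('n)"
    and "R \<equiv> \<Sum>j | j \<noteq> i. 1 / (x i + 2 * x j)"
    and "X \<equiv> \<Sum>j\<in>UNIV. x j"
    and "P \<equiv> (n^2 + 3 * n - 2) / 4 * x i - X / 2"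
    and "D \<equiv> x i * (X / 2 + (n + 6) / 4 * x i) * R - P"
    and "t \<equiv> \<lambda>j. - T / D *
      (if j = i then P - x i * (3/2 * X - (3 * n - 6) / 4 * x i) * R
       else P * (x i / (x i + 2 * x j))
         + x i * ((n + 2) / 2 * x j - X / 2 - (n + 6) / 4 * x i) * R)"
  assumes pos: "\<And>j. x j > 0"
    and D_nz: "D \<noteq> 0"
begin

text \<open>For every \<open>j\<close>, multiplying \<open>t j\<close> by
  \<open>(x j)^2 * quad_coeff x i j\<close> gives
  \<open>- T / D * (R * x j * ((n + 2) * x j - X - 2 * x i) - D)\<close>. The \<open>- D\<close>
  accounts for \<open>T * (1 / x j)^2\<close>; the rest, divided by \<open>(x j)^2\<close>, is
  affine in \<open>1 / x j\<close> and yields the two multipliers.\<close>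

lemma critical_point_stationary:
  "quad_coeff x i j * t j - T * (1 / x j)^2
    = - T / D * R * (n + 2) + T / D * R * (X + 2 * x i) * (1 / x j)"
proof (cases "j = i")
  case True
  have P: "P = x i * (X / 2 + (n + 6) / 4 * x i) * R - D" by (simp add: D_def)
  have "P - x i * (3/2 * X - (3 * n - 6) / 4 * x i) * R = x i * R * ((n + 2) * x i - X - 2 * x i) - D"
    unfolding P by (simp add: field_simps)
  then have "t i = - T / D * (x i * R * ((n + 2) * x i - X - 2 * x i) - D)"
    unfolding t_def by simp
  also have "\<dots> = T - T / D * (x i * R * ((n + 2) * x i - X - 2 * x i))"
    using D_nz by (simp add: field_simps)
  finally have "t i = T - T / D * (x i * R * ((n + 2) * x i - X - 2 * x i))" .
  then show ?thesis
    unfolding True using pos[of i] D_nz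
    by (simp only:) (simp add: quad_coeff_def field_simps power2_eq_square)
next
  case False
  have P: "P = x i * (X / 2 + (n + 6) / 4 * x i) * R - D" by (simp add: D_def)
  have nz: "x i + 2 * x j \<noteq> 0" "x i \<noteq> 0" "x j \<noteq> 0"
    using pos[of i] pos[of j] by linarith+
  let ?y = "x i + 2 * x j"
  have c: "quad_coeff x i j = ?y / (x i * (x j)^2)"
    using False nz by (simp add: quad_coeff_def field_simps power2_eq_square)
  \<comment> \<open>The factor \<open>?y / x i\<close> is \<open>(x j)^2 * quad_coeff x i j\<close>;
    it cancels the denominator \<open>?y\<close> in \<open>t j\<close>.\<close>
  have "?y / x i * t j = - T / D * (P * (?y / x i * (x i / ?y))
      + ?y / x i * x i * ((n + 2) / 2 * x j - X / 2 - (n + 6) / 4 * x i) * R)"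
  proof -
    have "k * (d * (P * q + x i * l * R)) = d * (P * (k * q) + k * x i * l * R)" for k d q l
      by (simp add: algebra_simps)
    then show ?thesis
      using False unfolding t_def by (simp only: if_False)
  qed
  also have "\<dots> = - T / D * (P + ?y * ((n + 2) / 2 * x j - X / 2 - (n + 6) / 4 * x i) * R)"
    using nz by simp
  also have "P + ?y * ((n + 2) / 2 * x j - X / 2 - (n + 6) / 4 * x i) * R
      = R * x j * ((n + 2) * x j - X - 2 * x i) - D"
    unfolding P by (simp add: field_simps)
  also have "- T / D * \<dots> = T - T / D * (R * x j * ((n + 2) * x j - X - 2 * x i))"
    using D_nz by (simp add: field_simps)
  finally have "quad_coeff x i j * t j
      = (T - T / D * (R * x j * ((n + 2) * x j - X - 2 * x i))) / (x j)^2"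
    unfolding c by (simp only: times_divide_eq_left divide_divide_eq_left[symmetric])
  then show ?thesis
    using nz D_nz by (simp only:) (simp add: field_simps power2_eq_square)
qed

text \<open>Each \<open>t j\<close> with \<open>j \<noteq> i\<close> combines
  \<open>1 / (x i + 2 * x j)\<close>, \<open>x j\<close> and \<open>1\<close>, which sum to
  \<open>R\<close>, \<open>X - x i\<close> and \<open>n - 1\<close>. By the value of
  \<open>P\<close> all numerators add up to \<open>- D\<close>.\<close>

lemma critical_point_sum: "(\<Sum>j\<in>UNIV. t j) = T"
proof -
  have card: "(\<Sum>j | j \<noteq> i. 1) = n - 1" and X: "(\<Sum>j | j \<noteq> i. x j) = X - x i"
    using sum_neq[of "\<lambda>_. 1 :: real" i] by (simp_all add: sum_neq n_def X_def)
  have "(\<Sum>j | j \<noteq> i. t j) = (\<Sum>j | j \<noteq> i. - T / D * (P * x i * (1 / (x i + 2 * x j))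
      + x i * R * ((n + 2) / 2) * x j - x i * R * (X / 2 + (n + 6) / 4 * x i) * 1))"
    unfolding t_def by (intro sum.cong refl) (simp add: algebra_simps)
  also have "\<dots> = - T / D * (P * x i * R + x i * R * ((n + 2) / 2) * (X - x i)
      - x i * R * (X / 2 + (n + 6) / 4 * x i) * (n - 1))"
    by (simp only: sum.distrib sum_subtractf sum_distrib_left[symmetric] card X R_def[symmetric])
  also have "(\<Sum>j | j \<noteq> i. t j) = (\<Sum>j\<in>UNIV. t j) - t i"
    by (rule sum_neq)
  also have "t i = - T / D * (P - x i * (3/2 * X - (3 * n - 6) / 4 * x i) * R)"
    by (simp add: t_def)
  finally have "(\<Sum>j\<in>UNIV. t j) = - T / D * (P * x i * R + x i * R * ((n + 2) / 2) * (X - x i)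
      - x i * R * (X / 2 + (n + 6) / 4 * x i) * (n - 1)
      + (P - x i * (3/2 * X - (3 * n - 6) / 4 * x i) * R))"
    by (simp only: distrib_left diff_eq_eq)
  also have "P * x i * R + x i * R * ((n + 2) / 2) * (X - x i)
      - x i * R * (X / 2 + (n + 6) / 4 * x i) * (n - 1)
      + (P - x i * (3/2 * X - (3 * n - 6) / 4 * x i) * R) = - D"
    unfolding D_def P_def by (simp add: field_simps power2_eq_square)
  finally show ?thesis using D_nz by simp
qed

text \<open>Partial fractions reduce everything to the sum of \<open>1 / x j\<close>,
  \<open>R\<close> and the number of indices; the first enters with factor \<open>- D\<close>, and
  all terms carrying \<open>R\<close> cancel.\<close>

lemma critical_point_weighted_sum: "(\<Sum>j\<in>UNIV. 1 / x j * t j) = (\<Sum>j\<in>UNIV. 1 / x j) * T"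
proof -
  let ?S = "\<Sum>j\<in>UNIV. 1 / x j"
  have P: "P = x i * (X / 2 + (n + 6) / 4 * x i) * R - D" by (simp add: D_def)
  have card: "(\<Sum>j | j \<noteq> i. 1) = n - 1" and S: "(\<Sum>j | j \<noteq> i. 1 / x j) = ?S - 1 / x i"
    using sum_neq[of "\<lambda>_. 1 :: real" i] by (simp_all add: sum_neq n_def)
  have xi: "x i > 0" by (rule pos)
  have "(\<Sum>j | j \<noteq> i. 1 / x j * t j) = (\<Sum>j | j \<noteq> i. - T / D *
      (- D * (1 / x j) - 2 * P * (1 / (x i + 2 * x j)) + x i * R * ((n + 2) / 2) * 1))"
  proof (intro sum.cong refl)
    fix j assume "j \<in> {j. j \<noteq> i}"
    then have t: "t j = - T / D * (P * (x i / (x i + 2 * x j))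
        + x i * ((n + 2) / 2 * x j - X / 2 - (n + 6) / 4 * x i) * R)"
      by (simp add: t_def)
    have nz: "x i + 2 * x j > 0" "x j > 0"
      using pos[of i] pos[of j] by linarith+
    have *: "1 / x j * (x i / (x i + 2 * x j)) = 1 / x j - 2 * (1 / (x i + 2 * x j))"
      using nz by (simp add: field_simps)
    have "1 / x j * t j = - T / D * (P * (1 / x j * (x i / (x i + 2 * x j)))
        + 1 / x j * x j * (x i * R * ((n + 2) / 2)) - 1 / x j * (x i * (X / 2 + (n + 6) / 4 * x i) * R))"
    proof -
      have "k * (d * (P * q + x i * ((n + 2) / 2 * x j - X / 2 - (n + 6) / 4 * x i) * R))
          = d * (P * (k * q) + k * x j * (x i * R * ((n + 2) / 2))
            - k * (x i * (X / 2 + (n + 6) / 4 * x i) * R))" for k d q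
        by (simp add: field_simps)
      then show ?thesis unfolding t .
    qed
    \<comment> \<open>The coefficient of \<open>1 / x j\<close> collects to
      \<open>P - x i * (X / 2 + (n + 6) / 4 * x i) * R\<close>, which is \<open>- D\<close>.\<close>
    also have "P * (1 / x j * (x i / (x i + 2 * x j)))
        + 1 / x j * x j * (x i * R * ((n + 2) / 2)) - 1 / x j * (x i * (X / 2 + (n + 6) / 4 * x i) * R)
        = - D * (1 / x j) - 2 * P * (1 / (x i + 2 * x j)) + x i * R * ((n + 2) / 2) * 1"
      unfolding * D_def using nz(2) by (simp add: algebra_simps)
    finally show "1 / x j * t j = - T / D *
        (- D * (1 / x j) - 2 * P * (1 / (x i + 2 * x j)) + x i * R * ((n + 2) / 2) * 1)" .
  qed
  also have "\<dots> = - T / D * (- D * (?S - 1 / x i) - 2 * P * R + x i * R * ((n + 2) / 2) * (n - 1))"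
    by (simp only: sum.distrib sum_subtractf sum_distrib_left[symmetric] card S R_def[symmetric])
  finally have "(\<Sum>j\<in>UNIV. 1 / x j * t j) = - T / D * (- D * (?S - 1 / x i) - 2 * P * R
      + x i * R * ((n + 2) / 2) * (n - 1)) + 1 / x i * t i"
    unfolding sum_neq by simp
  also have "1 / x i * t i = - T / D * (- D * (1 / x i) + R * (n * x i - X))"
  proof -
    have "P - x i * (3/2 * X - (3 * n - 6) / 4 * x i) * R = x i * R * (n * x i - X) - D"
      unfolding P by (simp add: field_simps)
    then have "t i = - T / D * (x i * R * (n * x i - X) - D)"
      unfolding t_def by simp
    then show ?thesis using xi by (simp add: field_simps)
  qed
  \<comment> \<open>The cancellation rests on
    \<open>2 * P = (n + 2) * (n - 1) / 2 * x i + n * x i - X\<close>.\<close>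
  also have "- T / D * (- D * (?S - 1 / x i) - 2 * P * R + x i * R * ((n + 2) / 2) * (n - 1))
      + - T / D * (- D * (1 / x i) + R * (n * x i - X)) = - T / D * (- D * ?S)"
    unfolding P_def by (simp add: field_simps power2_eq_square)
  also have "\<dots> = ?S * T" using D_nz by simp
  finally show ?thesis .
qed

end

section \<open>Translation from \<open>\<kappa>\<close> to \<open>x\<close>, and conclusion\<close>

text \<open>The sum of the \<open>x j\<close> is \<open>(n - 1) * H\<close>, and
  \<open>3 * H - 2 * \<kappa> $ j - \<kappa> $ i\<close> is \<open>x i + 2 * x j\<close>.\<close>

lemma Dden_eq:
  fixes \<kappa> :: "real ^ ('n::finite)" and i :: 'n
  defines "n \<equiv> real CARD('n)" and "x \<equiv> \<lambda>j. trH \<kappa> - \<kappa> $ j"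
  shows "Dden \<kappa> i = x i * ((\<Sum>j\<in>UNIV. x j) / 2 + (n + 6) / 4 * x i) * (\<Sum>j | j \<noteq> i. 1 / (x i + 2 * x j))
    - ((n^2 + 3 * n - 2) / 4 * x i - (\<Sum>j\<in>UNIV. x j) / 2)"
proof -
  have X: "(\<Sum>j\<in>UNIV. x j) = (n - 1) * trH \<kappa>"
    by (simp add: x_def n_def sum_subtractf trH_def left_diff_distrib)
  have k: "\<kappa> $ j = trH \<kappa> - x j" for j by (simp add: x_def)
  have R: "Rsum \<kappa> i = (\<Sum>j | j \<noteq> i. 1 / (x i + 2 * x j))"
    unfolding Rsum_def k by (simp add: algebra_simps)
  show ?thesis
    unfolding Dden_def Let_def R X n_def[symmetric] k by (simp add: field_simps power2_eq_square)
qed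

lemma tmin_eq:
  fixes \<kappa> :: "real ^ ('n::finite)" and i :: 'n
  defines "n \<equiv> real CARD('n)" and "x \<equiv> \<lambda>j. trH \<kappa> - \<kappa> $ j"
  defines "X \<equiv> \<Sum>j\<in>UNIV. x j" and "R \<equiv> \<Sum>j | j \<noteq> i. 1 / (x i + 2 * x j)"
  defines "P \<equiv> (n^2 + 3 * n - 2) / 4 * x i - X / 2"
  shows "tmin \<kappa> \<beta> \<nu> u w i $ j = - (\<beta> / \<nu> * (w / u) * (\<nu> - \<kappa> $ i) * trH \<kappa>) / Dden \<kappa> i *
      (if j = i then P - x i * (3/2 * X - (3 * n - 6) / 4 * x i) * R
       else P * (x i / (x i + 2 * x j))
         + x i * ((n + 2) / 2 * x j - X / 2 - (n + 6) / 4 * x i) * R)"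
proof -
  \<comment> \<open>The stated point carries \<open>\<kappa> $ i - \<nu>\<close>, the constraint
    \<open>\<nu> - \<kappa> $ i\<close>; this is the sign in \<open>- T / D\<close>.\<close>
  have T: "\<beta> / \<nu> * (w / u) * (\<kappa> $ i - \<nu>) * trH \<kappa> = - (\<beta> / \<nu> * (w / u) * (\<nu> - \<kappa> $ i) * trH \<kappa>)"
    unfolding minus_diff_eq[of \<nu> "\<kappa> $ i", symmetric] by (simp only: mult_minus_left mult_minus_right)
  have X: "X = (n - 1) * trH \<kappa>"
    by (simp add: X_def x_def n_def sum_subtractf trH_def left_diff_distrib)
  have k: "\<kappa> $ j = trH \<kappa> - x j" for j by (simp add: x_def)
  have R: "Rsum \<kappa> i = R"
    unfolding Rsum_def R_def k by (simp add: algebra_simps)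
  have P: "(n^2 + n) / 4 * trH \<kappa> - (n^2 + 3 * n - 2) / 4 * \<kappa> $ i = P"
    unfolding P_def X k by (simp add: field_simps power2_eq_square)
  have x: "trH \<kappa> - \<kappa> $ i = x i" and den: "3 * trH \<kappa> - 2 * \<kappa> $ j - \<kappa> $ i = x i + 2 * x j"
    by (simp_all add: k)
  have num_i: "1/4 * x i * (3 * n * trH \<kappa> + (3 * n - 6) * \<kappa> $ i) * R
      = x i * (3/2 * X - (3 * n - 6) / 4 * x i) * R"
    unfolding X k[of i] by (simp add: field_simps)
  have num_j: "- (n / 4) * trH \<kappa> - (n + 2) / 2 * \<kappa> $ j + (n / 4 + 3 / 2) * \<kappa> $ i
      = (n + 2) / 2 * x j - X / 2 - (n + 6) / 4 * x i"
    unfolding X k[of i] k[of j] by (simp add: field_simps)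
  show ?thesis
    unfolding tmin_def Let_def vec_lambda_beta n_def[symmetric] R P x den num_i num_j T
    by simp
qed

theorem theorem4p22:
  fixes \<kappa> :: "real ^ ('n::{finite,linorder})" and \<sigma> \<beta> \<nu> u u\<^sub>i :: real and i :: 'n
  assumes "CARD('n) \<ge> 2"
    and "\<sigma> > 0"
    and "\<And>j. trH \<kappa> - \<kappa> $ j > 0"
    and "(\<Prod>j\<in>UNIV. (trH \<kappa> - \<kappa> $ j)) = ((real CARD('n) - 1) * \<sigma>) ^ CARD('n)"
    and "\<beta> > 1" and "\<nu> > 0" and "u > 0"
    and "Dden \<kappa> i \<noteq> 0"
  shows "is_arg_min (Qform \<sigma> \<kappa> \<beta> \<nu> u u\<^sub>i i) (feasible \<sigma> \<kappa> \<beta> \<nu> u u\<^sub>i i) (tmin \<kappa> \<beta> \<nu> u u\<^sub>i i)"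
proof -
  define x where "x = (\<lambda>j. trH \<kappa> - \<kappa> $ j)"
  define T where "T = \<beta> / \<nu> * (u\<^sub>i / u) * (\<nu> - \<kappa> $ i) * trH \<kappa>"
  let ?t = "tmin \<kappa> \<beta> \<nu> u u\<^sub>i i" and ?F = "feasible \<sigma> \<kappa> \<beta> \<nu> u u\<^sub>i i"
  have pos: "x j > 0" for j
    using assms(3) by (simp add: x_def)
  let ?n = "real CARD('n)" and ?X = "\<Sum>j\<in>UNIV. x j" and ?R = "\<Sum>j | j \<noteq> i. 1 / (x i + 2 * x j)"
  let ?P = "(?n^2 + 3 * ?n - 2) / 4 * x i - ?X / 2"
  have D: "Dden \<kappa> i = x i * (?X / 2 + (?n + 6) / 4 * x i) * ?R - ?P"
    unfolding x_def by (rule Dden_eq)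
  have t: "?t $ j = - T / (x i * (?X / 2 + (?n + 6) / 4 * x i) * ?R - ?P) *
      (if j = i then ?P - x i * (3/2 * ?X - (3 * ?n - 6) / 4 * x i) * ?R
       else ?P * (x i / (x i + 2 * x j))
         + x i * ((?n + 2) / 2 * x j - ?X / 2 - (?n + 6) / 4 * x i) * ?R)" for j
    unfolding D[symmetric] unfolding T_def x_def by (rule tmin_eq)
  note facts = pos assms(8)[unfolded D]
  have feas: "?F s \<longleftrightarrow> (\<Sum>j\<in>UNIV. s $ j) = T \<and> (\<Sum>j\<in>UNIV. 1 / x j * s $ j) = (\<Sum>j\<in>UNIV. 1 / x j) * T"
    for s
    unfolding feasible_iff[OF assms(2)] T_def[symmetric] x_def by auto
  have "?F ?t"
    unfolding feas t
    using critical_point_sum[where x = x and i = i and T = T, OF facts] critical_point_weighted_sum[where x = x and i = i and T = T, OF facts]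
    by blast
  moreover have "Qform \<sigma> \<kappa> \<beta> \<nu> u u\<^sub>i i ?t \<le> Qform \<sigma> \<kappa> \<beta> \<nu> u u\<^sub>i i s" if "?F s" for s
  proof -
    have c: "quad_coeff x i j \<ge> 0" for j
      using pos[of i] pos[of j] by (simp add: quad_coeff_def)
    have "(\<Sum>j\<in>UNIV. quad_coeff x i j * (?t $ j)^2 - 2 * (T * (1 / x j)^2 * ?t $ j))
        \<le> (\<Sum>j\<in>UNIV. quad_coeff x i j * (s $ j)^2 - 2 * (T * (1 / x j)^2 * s $ j))"
    \<comment> \<open>Here \<open>b j\<close> is \<open>T * (1 / x j)^2\<close>, and the constraint
      vectors are the constant one and \<open>1 / x j\<close>.\<close>
    proof (rule lagrange_sufficient[where a = "\<lambda>j. 1 / x j"])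
      show "quad_coeff x i j * ?t $ j - T * (1 / x j)^2
          = - T / Dden \<kappa> i * ?R * (?n + 2) + T / Dden \<kappa> i * ?R * (?X + 2 * x i) * (1 / x j)" for j
        unfolding D t using critical_point_stationary[where x = x and i = i and T = T, OF facts] .
    qed (use c that \<open>?F ?t\<close> in \<open>simp_all only: feas\<close>)
    \<comment> \<open>The two values of \<open>Qform\<close> share the additive constant and the
      positive factor \<open>\<sigma> / n\<close>.\<close>
    then show ?thesis
      unfolding Qform_eq_on_feasible[OF assms(2) that] Qform_eq_on_feasible[OF assms(2) \<open>?F ?t\<close>]
        T_def[symmetric] x_def[symmetric]
      using assms(2) by (intro mult_left_mono add_right_mono) (simp_all add: x_def mult.assoc)
  qed
  ultimately show ?thesis
    unfolding is_arg_min_def by (auto simp: not_less)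
qed

end
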